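(* Let $G=(N,A)$ be a directed graph with $N=\{1,\dots,n\}$ and $m$ arcs, and let $Q\in\mathbb{R}^{m\times m}$. If there exist $B,C\in\mathbb{R}^{m\times n}$ and $t\in\mathbb{R}^m$ such that $Q_{ef}=B_{e,f^+}+C_{e,f^-}$ for all $e,f\in A$ with $e\neq f$, and $Q_{ee}=B_{e,e^+}+C_{e,e^-}+t_e$ for all $e\in A$, then $Q$ is linearizable with vector $p$ given by $$p_e=t_e+\sum_{i=1}^n B_{e,i}+\sum_{i=1}^n C_{e,i}\qquad\text{for all }e\in A,$$ i.e. $x^TQx=p^Tx$ for all $x\in X$.
   Context: $G=(N,A)$ is a directed graph, $A\subseteq N\times N$, $|A|=m$; matrices and vectors of dimension $m$ are indexed by arcs. For an arc $e$, $e^+$ is its starting node and $e^-$ its ending node. For $i\in N$, $\delta^+(i)$ and $\delta^-(i)$ are the sets of arcs leaving and entering $i$. The set of (disjoint) cycle covers is $$X=\Big\{x\in\{0,1\}^m : \sum_{e\in\delta^+(i)}x_e=\sum_{e\in\delta^-(i)}x_e=1\ \ \forall i\in N\Big\}.$$ $Q$ is linearizable with vector $p\in\mathbb{R}^m$ if $x^TQx=p^Tx$ for all $x\in X$. Here $Q$ may have nonzero entries for arbitrary pairs of arcs. *)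

theory Defs
  imports Complex_Main "HOL-Library.FuncSet" "Graph_Theory.Pair_Digraph"
begin

text \<open>Vectors and matrices indexed by the arcs are functions on arcs. The values of matrices and
  of the vector \<open>p\<close> outside the arc set never enter; vectors in \<open>cycle_covers\<close>
  are normalised outside the arc set by \<open>\<rightarrow>\<^sub>E\<close>.\<close>

definition cycle_covers :: "('a, 'b) pre_digraph \<Rightarrow> ('b \<Rightarrow> real) set" where
  "cycle_covers G = {x \<in> arcs G \<rightarrow>\<^sub>E {0, 1}.
     \<forall>i \<in> verts G. (\<Sum>e \<in> out_arcs G i. x e) = 1 \<and> (\<Sum>e \<in> in_arcs G i. x e) = 1}"

definition linearizable_with ::
  "('a, 'b) pre_digraph \<Rightarrow> ('b \<Rightarrow> 'b \<Rightarrow> real) \<Rightarrow> ('b \<Rightarrow> real) \<Rightarrow> bool" where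
  "linearizable_with G Q p \<longleftrightarrow>
     (\<forall>x \<in> cycle_covers G.
        (\<Sum>e \<in> arcs G. \<Sum>f \<in> arcs G. x e * Q e f * x f) = (\<Sum>e \<in> arcs G. p e * x e))"

end

theory Submission
  imports Defs
begin

text \<open>A cycle cover gives every node total out-weight 1 and total in-weight 1, so a sum over arcs
  whose terms depend only on the tail (or only on the head), weighted by the cover, collapses to a
  plain sum over nodes and no longer depends on the cover (lemmas \<open>cycle_cover_sum_tail\<close> and
  \<open>cycle_cover_sum_head\<close>). The row of \<open>Q\<close> at an arc \<open>e\<close> is a tail-dependent term plus a
  head-dependent term plus a correction \<open>t e\<close> on the diagonal. Its product with the cover is
  therefore the constant \<open>\<Sum>\<^sub>i B e i + \<Sum>\<^sub>i C e i\<close> plus \<open>t e * x e\<close>. Multiplying by \<open>x e\<close> and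
  using \<open>x e * x e = x e\<close> for a 0/1 value makes the quadratic form linear.\<close>

text \<open>Grouping the arcs by their tails, each group contributes its out-weight 1.\<close>
lemma cycle_cover_sum_tail:
  assumes "fin_digraph G" and "x \<in> cycle_covers G"
  shows "(\<Sum>f \<in> arcs G. b (tail G f) * x f) = (\<Sum>i \<in> verts G. b i)"
proof -
  interpret fin_digraph G by fact
  have "(\<Sum>f \<in> arcs G. b (tail G f) * x f)
      = (\<Sum>i \<in> verts G. \<Sum>f \<in> {f \<in> arcs G. tail G f = i}. b (tail G f) * x f)"
    by (rule sum.group[symmetric]) auto
  also have "\<dots> = (\<Sum>i \<in> verts G. b i * (\<Sum>f \<in> out_arcs G i. x f))"
    by (simp add: out_arcs_def sum_distrib_left)
  also have "\<dots> = (\<Sum>i \<in> verts G. b i)"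
    using assms(2) by (simp add: cycle_covers_def)
  finally show ?thesis .
qed

lemma cycle_cover_sum_head:
  assumes "fin_digraph G" and "x \<in> cycle_covers G"
  shows "(\<Sum>f \<in> arcs G. c (head G f) * x f) = (\<Sum>i \<in> verts G. c i)"
proof -
  interpret fin_digraph G by fact
  have "(\<Sum>f \<in> arcs G. c (head G f) * x f)
      = (\<Sum>i \<in> verts G. \<Sum>f \<in> {f \<in> arcs G. head G f = i}. c (head G f) * x f)"
    by (rule sum.group[symmetric]) auto
  also have "\<dots> = (\<Sum>i \<in> verts G. c i * (\<Sum>f \<in> in_arcs G i. x f))"
    by (simp add: in_arcs_def sum_distrib_left)
  also have "\<dots> = (\<Sum>i \<in> verts G. c i)"
    using assms(2) by (simp add: cycle_covers_def)
  finally show ?thesis .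
qed

lemma linearizable_with_node_sums:
  assumes fin: "fin_digraph G"
    and Q: "\<And>e f. e \<in> arcs G \<Longrightarrow> f \<in> arcs G \<Longrightarrow>
           Q e f = B e (tail G f) + C e (head G f) + (if e = f then t e else 0)"
  shows "linearizable_with G Q
           (\<lambda>e. t e + (\<Sum>i \<in> verts G. B e i) + (\<Sum>i \<in> verts G. C e i))"
  unfolding linearizable_with_def
proof (intro ballI sum.cong refl)
  interpret fin_digraph G by fact
  fix x e assume x: "x \<in> cycle_covers G" and e: "e \<in> arcs G"
  have "x e \<in> {0, 1}"
    using x e by (auto simp: cycle_covers_def)
  then have idem: "x e * x e = x e"
    by auto
  have "(\<Sum>f \<in> arcs G. x e * Q e f * x f) = (\<Sum>f \<in> arcs G.
      x e * (B e (tail G f) * x f + C e (head G f) * x f + (if e = f then t e * x f else 0)))"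
    by (rule sum.cong) (auto simp: Q[OF e] algebra_simps)
  also have "\<dots> = x e * ((\<Sum>f \<in> arcs G. B e (tail G f) * x f)
      + (\<Sum>f \<in> arcs G. C e (head G f) * x f) + t e * x e)"
    using e by (simp add: sum_distrib_left[symmetric] sum.distrib)
  also have "\<dots> = x e * ((\<Sum>i \<in> verts G. B e i) + (\<Sum>i \<in> verts G. C e i)) + t e * (x e * x e)"
    unfolding cycle_cover_sum_tail[OF fin x, of "B e"] cycle_cover_sum_head[OF fin x, of "C e"]
    by (simp add: algebra_simps)
  also have "\<dots> = (t e + (\<Sum>i \<in> verts G. B e i) + (\<Sum>i \<in> verts G. C e i)) * x e"
    by (simp add: idem algebra_simps)
  finally show "(\<Sum>f \<in> arcs G. x e * Q e f * x f)
      = (t e + (\<Sum>i \<in> verts G. B e i) + (\<Sum>i \<in> verts G. C e i)) * x e" .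
qed

theorem proposition7:
  fixes G :: "nat pair_pre_digraph" and n :: nat
    and Q :: "nat \<times> nat \<Rightarrow> nat \<times> nat \<Rightarrow> real"
    and B C :: "nat \<times> nat \<Rightarrow> nat \<Rightarrow> real"
    and t :: "nat \<times> nat \<Rightarrow> real"
  assumes "pair_wf_digraph G"
    and "pverts G = {1..n}"
    and "\<And>e f. e \<in> parcs G \<Longrightarrow> f \<in> parcs G \<Longrightarrow> e \<noteq> f \<Longrightarrow>
           Q e f = B e (tail G f) + C e (head G f)"
    and "\<And>e. e \<in> parcs G \<Longrightarrow> Q e e = B e (tail G e) + C e (head G e) + t e"
  shows "linearizable_with G Q (\<lambda>e. t e + (\<Sum>i = 1..n. B e i) + (\<Sum>i = 1..n. C e i))"
proof -
  interpret pair_wf_digraph G by fact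
  \<comment> \<open>Arcs are pairs of nodes, so finitely many nodes leave only finitely many arcs.\<close>
  have "parcs G \<subseteq> {1..n} \<times> {1..n}"
    using arc_fst_in_verts arc_snd_in_verts assms(2) by fastforce
  then have "finite (parcs G)"
    by (rule finite_subset) simp
  then have "fin_digraph (with_proj G)"
    by unfold_locales (simp_all add: assms(2))
  then have "linearizable_with G Q
      (\<lambda>e. t e + (\<Sum>i \<in> verts G. B e i) + (\<Sum>i \<in> verts G. C e i))"
    by (rule linearizable_with_node_sums) (use assms(3,4) in auto)
  then show ?thesis
    by (simp add: assms(2))
qed

end
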